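(* Let $G$ be an abelian group. For any commutative unital ring $R$, the branch circle operation $\mathbf{m}$ induces a bialgebra structure on the group ring $A=R[G]$ if and only if every non-identity element of $G$ has order $2$.
   Context: The group ring $A=R[G]$ is regarded as a commutative Frobenius algebra with the group ring multiplication, unit $\eta(1)=1_G$ (where $1_G$ is the identity element of $G$), Frobenius form $\epsilon$ determined by $\epsilon(1_G)=1$ and $\epsilon(x)=0$ for $x\in G$, $x\neq 1_G$, and Frobenius comultiplication $\Delta(x)=\sum_{x=yz}y\otimes z$, so $\Delta(1_G)=\sum_{y\in G}y\otimes y^{-1}$. A bialgebra is an algebra $A$ over $R$ with a comultiplication $A\to A\otimes A$ that is an algebra homomorphism, and a counit $A\to R$ for which applying the counit to either tensor factor after the comultiplication gives the identity. The bialgebra (indeed Hopf algebra) structure on $A=R[G]$ under consideration has the group ring multiplication, the unit $\eta$ above, and the comultiplication $\mathbf{\Delta}:A\to A\otimes A$ obtained by linearly extending $\mathbf{\Delta}(x)=x\otimes x$ for $x\in G$; this is different from the Frobenius comultiplication $\Delta$. Foams are 2-dimensional complexes with branch curves along which three sheets meet, with facets decorated by elements of $A$. The theta foam is a sphere with an additional disk glued along a branch circle. Its three facets, decorated by $\alpha,\beta,\gamma$ in cyclic order around the branch circle, give a value $\theta(\alpha,\beta,\gamma)\in R$. These values are to be specified on basis elements, extended multilinearly, and required to satisfy the cyclic symmetry $\theta(\alpha,\beta,\gamma)=\theta(\beta,\gamma,\alpha)=\theta(\gamma,\alpha,\beta)$. The branch circle operation $\mathbf{m}:A\otimes A\to A$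 is the linear map assigned to the cobordism in which two circles merge into one along a branch circle; the upside-down cobordism, in which one circle branches into two, is assigned a linear map $\mathbf{\Delta}:A\to A\otimes A$, and it is this map that is to serve as the bialgebra comultiplication above. Both are determined by the theta foam values by cutting outgoing tubes using $\Delta(1_G)=\sum_{y\in G} y\otimes y^{-1}$: $$\mathbf{m}(u\otimes v)=\sum_{y\in G}\theta(y,u,v)\,y^{-1},\qquad \mathbf{\Delta}(x)=\sum_{y,z\in G}\theta(x,y^{-1},z^{-1})\,z\otimes y .$$ *)

theory Defs
  imports Complex_Main "HOL-Library.Poly_Mapping" "HOL-Library.Product_Plus"
begin

section \<open>Group rings\<close>

text \<open>
  The abelian group \<open>G\<close> is a type \<open>'g\<close> of class \<^class>\<open>ab_group_add\<close>, hence written additively: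
  \<open>0\<close> is the identity of \<open>G\<close> and \<open>- x\<close> is the inverse of \<open>x\<close>.  The group ring \<open>R[G]\<close> is
  \<open>'g \<Rightarrow>\<^sub>0 'r\<close>, whose product \<open>*\<close> is convolution, i.e. the group ring multiplication, and whose
  unit is \<open>1 = basis 0\<close>.  The tensor product \<open>R[G] \<otimes> R[G]\<close> is the group ring
  \<open>R[G \<times> G] = ('g \<times> 'g) \<Rightarrow>\<^sub>0 'r\<close>, with \<open>a \<otimes> b\<close> given by \<open>tensor a b\<close>; this is justified by
  \<open>tensor_mult\<close>, \<open>one_tensor_one\<close> and \<open>tensor_universal\<close> below.
\<close>

definition basis :: "'k \<Rightarrow> 'k \<Rightarrow>\<^sub>0 'r::comm_ring_1"
  where "basis x = Poly_Mapping.single x 1"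

definition smult :: "'r \<Rightarrow> ('k \<Rightarrow>\<^sub>0 'r) \<Rightarrow> ('k \<Rightarrow>\<^sub>0 'r::comm_ring_1)"
  where "smult c a = Poly_Mapping.map ((*) c) a"

definition lin_ext :: "('r \<Rightarrow> 'm \<Rightarrow> 'm) \<Rightarrow> ('k \<Rightarrow> 'm) \<Rightarrow> ('k \<Rightarrow>\<^sub>0 'r::comm_ring_1) \<Rightarrow> 'm::ab_group_add"
  where "lin_ext s g a = (\<Sum>x\<in>Poly_Mapping.keys a. s (Poly_Mapping.lookup a x) (g x))"

definition tensor :: "('g \<Rightarrow>\<^sub>0 'r) \<Rightarrow> ('g \<Rightarrow>\<^sub>0 'r) \<Rightarrow> ('g \<times> 'g \<Rightarrow>\<^sub>0 'r::comm_ring_1)" (infixr \<open>\<otimes>\<close> 75)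
  where "a \<otimes> b = lin_ext smult (\<lambda>x. lin_ext smult (\<lambda>y. basis (x, y)) b) a"

lemma lookup_smult: "Poly_Mapping.lookup (smult c a) x = c * Poly_Mapping.lookup a x"
  by (simp add: smult_def Poly_Mapping.map.rep_eq when_def)

lemma module_smult: "module (smult :: 'r::comm_ring_1 \<Rightarrow> ('k \<Rightarrow>\<^sub>0 'r) \<Rightarrow> _)"
  by standard (auto intro!: poly_mapping_eqI simp: lookup_smult lookup_add algebra_simps)

lemma module_mult: "module ((*) :: 'r::comm_ring_1 \<Rightarrow> 'r \<Rightarrow> 'r)"
  by standard (auto simp: algebra_simps)

lemma lin_ext_superset:
  assumes "module s" "finite S" "Poly_Mapping.keys a \<subseteq> S"
  shows "lin_ext s g a = (\<Sum>x\<in>S. s (Poly_Mapping.lookup a x) (g x))"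
proof -
  interpret module s by fact
  show ?thesis unfolding lin_ext_def
    by (rule sum.mono_neutral_left) (use assms in \<open>auto simp: in_keys_iff\<close>)
qed

lemma lin_ext_hom:
  fixes s :: "'b::comm_ring_1 \<Rightarrow> 'm::ab_group_add \<Rightarrow> 'm" and g :: "'a \<Rightarrow> 'm"
  assumes "module s"
  shows "module_hom smult s (lin_ext s g)"
proof -
  interpret s: module s by fact
  interpret module_pair smult s
    by (simp add: module_pair_def module_smult assms)
  show ?thesis
  proof (unfold module_hom_iff, intro conjI allI)
    fix a b :: "'a \<Rightarrow>\<^sub>0 'b"
    let ?S = "Poly_Mapping.keys a \<union> Poly_Mapping.keys b"
    show "lin_ext s g (a + b) = lin_ext s g a + lin_ext s g b"
      using lin_ext_superset[OF assms, of ?S a g] lin_ext_superset[OF assms, of ?S b g]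
        lin_ext_superset[OF assms, of ?S "a + b" g]
      by (simp add: keys_add lookup_add s.scale_left_distrib sum.distrib)
  next
    fix c and a :: "'a \<Rightarrow>\<^sub>0 'b"
    have "Poly_Mapping.keys (smult c a) \<subseteq> Poly_Mapping.keys a"
      by (auto simp: in_keys_iff lookup_smult)
    then show "lin_ext s g (smult c a) = s c (lin_ext s g a)"
      using lin_ext_superset[OF assms, of "Poly_Mapping.keys a" "smult c a" g]
        lin_ext_superset[OF assms, of "Poly_Mapping.keys a" a g]
      by (simp add: lookup_smult s.scale_sum_right)
  qed (simp_all add: module_smult assms)
qed

lemma lin_ext_basis:
  assumes "module s"
  shows "lin_ext s g (basis x) = g x"
proof -
  interpret module s by fact
  show ?thesis by (simp add: lin_ext_def basis_def)
qed

lemma basis_expansion: "(a :: 'k \<Rightarrow>\<^sub>0 'r::comm_ring_1) = lin_ext smult basis a"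
proof (rule poly_mapping_eqI)
  fix k
  have "Poly_Mapping.lookup (lin_ext smult basis a) k =
      (\<Sum>x\<in>Poly_Mapping.keys a. if x = k then Poly_Mapping.lookup a k else 0)"
    unfolding lin_ext_def lookup_sum
    by (rule sum.cong) (auto simp: lookup_smult basis_def lookup_single when_def)
  then show "Poly_Mapping.lookup a k = Poly_Mapping.lookup (lin_ext smult basis a) k"
    by (auto simp: in_keys_iff)
qed

lemma lin_ext_unique:
  assumes "module_hom smult s f" and "\<And>x. f (basis x) = g x"
  shows "f a = lin_ext s g a"
proof -
  interpret module_hom smult s f by fact
  have "f a = f (lin_ext smult basis a)" by (simp flip: basis_expansion)
  then show ?thesis by (simp add: lin_ext_def sum scale assms(2))
qed

lemma lookup_tensor:
  "Poly_Mapping.lookup (a \<otimes> b) (x, y) = Poly_Mapping.lookup a x * Poly_Mapping.lookup b y"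
proof -
  have "Poly_Mapping.lookup (lin_ext smult (\<lambda>y. basis (u, y)) b) (x, y) =
      (if u = x then Poly_Mapping.lookup b y else 0)" for u
  proof -
    have "Poly_Mapping.lookup (lin_ext smult (\<lambda>y. basis (u, y)) b) (x, y) =
       (\<Sum>v\<in>Poly_Mapping.keys b. if v = y then (if u = x then Poly_Mapping.lookup b y else 0) else 0)"
      unfolding lin_ext_def lookup_sum
      by (rule sum.cong) (auto simp: lookup_smult basis_def lookup_single when_def)
    then show ?thesis by (auto simp: in_keys_iff)
  qed
  then have "Poly_Mapping.lookup (a \<otimes> b) (x, y) = (\<Sum>u\<in>Poly_Mapping.keys a.
      if u = x then Poly_Mapping.lookup a x * Poly_Mapping.lookup b y else 0)"
    unfolding tensor_def lin_ext_def[of smult _ a] lookup_sum lookup_smult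
    by (intro sum.cong) auto
  then show ?thesis by (auto simp: in_keys_iff)
qed

lemma tensor_basis: "basis x \<otimes> basis y = basis (x, y)"
  by (simp add: tensor_def lin_ext_basis module_smult)

lemma tensor_bilinear:
  "module_hom smult smult (\<lambda>a. a \<otimes> b)" "module_hom smult smult (\<lambda>b. a \<otimes> b)"
  unfolding module_hom_iff
  by (auto simp: module_smult lookup_tensor lookup_add lookup_smult algebra_simps
      intro!: poly_mapping_eqI)

lemma tensor_add: "(a + b) \<otimes> c = a \<otimes> c + b \<otimes> c" "a \<otimes> (b + c) = a \<otimes> b + a \<otimes> c"
  and tensor_smult: "smult r a \<otimes> c = smult r (a \<otimes> c)" "a \<otimes> smult r c = smult r (a \<otimes> c)"
  using tensor_bilinear unfolding module_hom_iff by blast+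

lemma tensor_single:
  "Poly_Mapping.single x r \<otimes> Poly_Mapping.single y s = Poly_Mapping.single (x, y) (r * s)"
  by (auto intro!: poly_mapping_eqI simp: lookup_tensor lookup_single when_def)

lemma one_tensor_one: "(1 :: 'g::ab_group_add \<Rightarrow>\<^sub>0 'r::comm_ring_1) \<otimes> 1 = 1"
  by (simp add: tensor_single flip: single_one zero_prod_def)

lemma basis_mult: "basis x * basis y = basis (x + y)"
  by (simp add: basis_def mult_single)

lemma single_sum_induct:
  assumes single: "\<And>x r. P (Poly_Mapping.single x r)" and add: "\<And>a b. P a \<Longrightarrow> P b \<Longrightarrow> P (a + b)"
  shows "P (a :: 'k \<Rightarrow>\<^sub>0 'r::comm_ring_1)"
proof -
  have b: "smult r (basis x) = Poly_Mapping.single x r" for r and x :: 'k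
    by (auto intro!: poly_mapping_eqI simp: basis_def lookup_smult lookup_single when_def)
  have "P (\<Sum>x\<in>S. Poly_Mapping.single x (Poly_Mapping.lookup a x))" if "finite S" for S
    using that
  proof induction
    case empty
    show ?case using single[of _ 0] by simp
  qed (simp add: single add)
  then have "P (lin_ext smult basis a)" by (simp add: lin_ext_def b)
  then show ?thesis by (simp flip: basis_expansion)
qed

lemma smult_conv_mult:
  "smult c a = Poly_Mapping.single 0 c * (a :: 'g::ab_group_add \<Rightarrow>\<^sub>0 'r::comm_ring_1)"
proof (induct a rule: single_sum_induct)
  case (1 x r)
  show ?case
    by (auto intro!: poly_mapping_eqI simp: mult_single lookup_smult lookup_single when_def)
qed (simp add: distrib_left module.scale_right_distrib[OF module_smult])

lemma tensor_mult:
  fixes a b c d :: "'g::ab_group_add \<Rightarrow>\<^sub>0 'r::comm_ring_1"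
  shows "(a \<otimes> b) * (c \<otimes> d) = (a * c) \<otimes> (b * d)"
proof -
  have 1: "(Poly_Mapping.single x r \<otimes> Poly_Mapping.single y s) *
      (Poly_Mapping.single u p \<otimes> Poly_Mapping.single v q) =
      (Poly_Mapping.single x r * Poly_Mapping.single u p) \<otimes>
      (Poly_Mapping.single y s * Poly_Mapping.single v q)" for x y u v :: 'g and r s p q :: 'r
    by (simp add: tensor_single mult_single algebra_simps)
  have 2: "(Poly_Mapping.single x r \<otimes> Poly_Mapping.single y s) *
      (Poly_Mapping.single u p \<otimes> d) =
      (Poly_Mapping.single x r * Poly_Mapping.single u p) \<otimes>
      (Poly_Mapping.single y s * d)" for x y u :: 'g and r s p :: 'r
    by (induct d rule: single_sum_induct) (simp_all only: 1 tensor_add distrib_left)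
  have 3: "(Poly_Mapping.single x r \<otimes> Poly_Mapping.single y s) * (c \<otimes> d) =
      (Poly_Mapping.single x r * c) \<otimes> (Poly_Mapping.single y s * d)" for x y :: 'g and r s :: 'r
    by (induct c rule: single_sum_induct) (simp_all only: 2 tensor_add distrib_left distrib_right)
  have 4: "(Poly_Mapping.single x r \<otimes> b) * (c \<otimes> d) =
      (Poly_Mapping.single x r * c) \<otimes> (b * d)" for x :: 'g and r :: 'r
    by (induct b rule: single_sum_induct) (simp_all only: 3 tensor_add distrib_left distrib_right)
  show ?thesis
    by (induct a rule: single_sum_induct) (simp_all only: 4 tensor_add distrib_left distrib_right)
qed

lemma tensor_universal:
  fixes s :: "'r::comm_ring_1 \<Rightarrow> 'm::ab_group_add \<Rightarrow> 'm"
    and B :: "('g \<Rightarrow>\<^sub>0 'r) \<Rightarrow> ('g \<Rightarrow>\<^sub>0 'r) \<Rightarrow> 'm"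
  assumes l: "\<And>b. module_hom smult s (\<lambda>a. B a b)" and r: "\<And>a. module_hom smult s (B a)"
  shows "\<exists>!f. module_hom smult s f \<and> (\<forall>a b. f (a \<otimes> b) = B a b)"
proof (rule ex1I)
  have s: "module s" using l unfolding module_hom_iff by blast
  let ?f = "lin_ext s (\<lambda>(x, y). B (basis x) (basis y))"
  have f: "module_hom smult s ?f" by (rule lin_ext_hom[OF s])
  have fb: "?f (basis x \<otimes> basis y) = B (basis x) (basis y)" for x y
    by (simp add: tensor_basis lin_ext_basis[OF s])
  have comp: "module_hom smult s (\<lambda>a. ?f (a \<otimes> b))" "module_hom smult s (\<lambda>b. ?f (a \<otimes> b))" for a b
    using f unfolding module_hom_iff by (simp_all add: tensor_add tensor_smult module_smult)
  have fb': "?f (basis x \<otimes> b) = B (basis x) b" for x b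
    by (rule trans[OF lin_ext_unique[OF comp(2) fb] lin_ext_unique[OF r refl, symmetric]])
  have "?f (a \<otimes> b) = B a b" for a b
    by (rule trans[OF lin_ext_unique[OF comp(1) fb'] lin_ext_unique[OF l refl, symmetric]])
  with f show "module_hom smult s ?f \<and> (\<forall>a b. ?f (a \<otimes> b) = B a b)" by blast
  fix h assume h: "module_hom smult s h \<and> (\<forall>a b. h (a \<otimes> b) = B a b)"
  have "h (basis p) = (case p of (x, y) \<Rightarrow> B (basis x) (basis y))" for p
    using h by (cases p) (simp flip: tensor_basis)
  then show "h = ?f" by (intro ext lin_ext_unique[OF conjunct1[OF h]])
qed


section \<open>Bialgebra structures on the group ring\<close>

definition contract_left :: "(('g \<Rightarrow>\<^sub>0 'r) \<Rightarrow> 'r) \<Rightarrow> ('g \<times> 'g \<Rightarrow>\<^sub>0 'r) \<Rightarrow> ('g \<Rightarrow>\<^sub>0 'r::comm_ring_1)"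
  where "contract_left e = lin_ext smult (\<lambda>(x, y). smult (e (basis x)) (basis y))"

definition contract_right :: "(('g \<Rightarrow>\<^sub>0 'r) \<Rightarrow> 'r) \<Rightarrow> ('g \<times> 'g \<Rightarrow>\<^sub>0 'r) \<Rightarrow> ('g \<Rightarrow>\<^sub>0 'r::comm_ring_1)"
  where "contract_right e = lin_ext smult (\<lambda>(x, y). smult (e (basis y)) (basis x))"

text \<open>For linear \<open>e\<close> these are \<open>e \<otimes> id\<close> and \<open>id \<otimes> e\<close>, up to \<open>R \<otimes> A \<cong> A \<cong> A \<otimes> R\<close>.\<close>

lemma contract_tensor:
  assumes "module_hom smult (*) e"
  shows "contract_left e (a \<otimes> b) = smult (e a) b" "contract_right e (a \<otimes> b) = smult (e b) a"
proof -
  note m = module_smult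
  have e: "e (x + y) = e x + e y" "e (smult c x) = c * e x" for x y c
    using assms unfolding module_hom_iff by blast+
  have L: "\<And>b. module_hom smult smult (\<lambda>a. smult (e a) b)" "\<And>a. module_hom smult smult (\<lambda>b. smult (e a) b)"
    and R: "\<And>b. module_hom smult smult (\<lambda>a. smult (e b) a)" "\<And>a. module_hom smult smult (\<lambda>b. smult (e b) a)"
    unfolding module_hom_iff
    by (auto simp: m e lookup_smult lookup_add algebra_simps intro!: poly_mapping_eqI)
  obtain f where f: "module_hom smult smult f" "\<And>a b. f (a \<otimes> b) = smult (e a) b"
    using tensor_universal[OF L] by blast
  have "f w = contract_left e w" for w
    unfolding contract_left_def by (rule lin_ext_unique[OF f(1)]) (auto simp flip: tensor_basis f(2))
  then show "contract_left e (a \<otimes> b) = smult (e a) b" using f(2) by simp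
  obtain f where f: "module_hom smult smult f" "\<And>a b. f (a \<otimes> b) = smult (e b) a"
    using tensor_universal[OF R] by blast
  have "f w = contract_right e w" for w
    unfolding contract_right_def by (rule lin_ext_unique[OF f(1)]) (auto simp flip: tensor_basis f(2))
  then show "contract_right e (a \<otimes> b) = smult (e b) a" using f(2) by simp
qed

text \<open>
  \<open>D\<close> makes the algebra \<open>R[G]\<close> a bialgebra: it is an algebra homomorphism and admits a counit.
\<close>

definition bialgebra_comult ::
  "(('g::ab_group_add \<Rightarrow>\<^sub>0 'r::comm_ring_1) \<Rightarrow> ('g \<times> 'g \<Rightarrow>\<^sub>0 'r)) \<Rightarrow> bool"
  where "bialgebra_comult D \<longleftrightarrow>
    module_hom smult smult D \<and> D 1 = 1 \<and> (\<forall>a b. D (a * b) = D a * D b) \<and>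
    (\<exists>e. module_hom smult (*) e \<and>
      (\<forall>a. contract_left e (D a) = a) \<and> (\<forall>a. contract_right e (D a) = a))"

definition grouplike_comult :: "('g \<Rightarrow>\<^sub>0 'r) \<Rightarrow> ('g \<times> 'g \<Rightarrow>\<^sub>0 'r::comm_ring_1)"
  where "grouplike_comult = lin_ext smult (\<lambda>x. basis x \<otimes> basis x)"


section \<open>Theta foam values and branch circle operations\<close>

definition theta_foam :: "(('g \<Rightarrow>\<^sub>0 'r) \<Rightarrow> ('g \<Rightarrow>\<^sub>0 'r) \<Rightarrow> ('g \<Rightarrow>\<^sub>0 'r) \<Rightarrow> 'r::comm_ring_1) \<Rightarrow> bool"
  where "theta_foam \<theta> \<longleftrightarrow>
    (\<forall>b c. module_hom smult (*) (\<lambda>a. \<theta> a b c)) \<and>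
    (\<forall>a c. module_hom smult (*) (\<lambda>b. \<theta> a b c)) \<and>
    (\<forall>a b. module_hom smult (*) (\<lambda>c. \<theta> a b c)) \<and>
    (\<forall>a b c. \<theta> a b c = \<theta> b c a \<and> \<theta> b c a = \<theta> c a b)"

text \<open>
  The operations obtained from \<open>\<theta>\<close> by cutting tubes.  For finite \<open>G\<close> the finiteness conditions
  hold automatically and \<open>Sum_any\<close> is the ordinary sum over \<open>G\<close> or \<open>G \<times> G\<close>.  For infinite \<open>G\<close>
  they state that the sums define elements of \<open>R[G]\<close> and \<open>R[G] \<otimes> R[G]\<close>.
\<close>

definition branch_merge ::
  "(('g \<Rightarrow>\<^sub>0 'r) \<Rightarrow> ('g \<Rightarrow>\<^sub>0 'r) \<Rightarrow> ('g \<Rightarrow>\<^sub>0 'r) \<Rightarrow> 'r) \<Rightarrow>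
    (('g \<times> 'g \<Rightarrow>\<^sub>0 'r) \<Rightarrow> ('g::ab_group_add \<Rightarrow>\<^sub>0 'r::comm_ring_1)) \<Rightarrow> bool"
  where "branch_merge \<theta> m \<longleftrightarrow> module_hom smult smult m \<and>
    (\<forall>u v. finite {y. \<theta> (basis y) u v \<noteq> 0} \<and>
      m (u \<otimes> v) = Sum_any (\<lambda>y. smult (\<theta> (basis y) u v) (basis (- y))))"

definition branch_split ::
  "(('g \<Rightarrow>\<^sub>0 'r) \<Rightarrow> ('g \<Rightarrow>\<^sub>0 'r) \<Rightarrow> ('g \<Rightarrow>\<^sub>0 'r) \<Rightarrow> 'r) \<Rightarrow>
    (('g::ab_group_add \<Rightarrow>\<^sub>0 'r::comm_ring_1) \<Rightarrow> ('g \<times> 'g \<Rightarrow>\<^sub>0 'r)) \<Rightarrow> bool"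
  where "branch_split \<theta> D \<longleftrightarrow> module_hom smult smult D \<and>
    (\<forall>x. finite {(y, z). \<theta> x (basis (- y)) (basis (- z)) \<noteq> 0} \<and>
      D x = Sum_any (\<lambda>(y, z). smult (\<theta> x (basis (- y)) (basis (- z))) (basis z \<otimes> basis y)))"


section \<open>Orders of group elements\<close>

text \<open>\<open>((+) x ^^ n) 0\<close> is the \<open>n\<close>-th power of \<open>x\<close>; the value \<open>0\<close> encodes infinite order.\<close>

definition element_order :: "'g::ab_group_add \<Rightarrow> nat"
  where "element_order x =
    (if \<exists>n>0. ((+) x ^^ n) 0 = 0 then LEAST n. 0 < n \<and> ((+) x ^^ n) 0 = 0 else 0)"

end

theory Submission
  imports Defs
begin

text \<open>
  Cutting tubes identifies the coefficient of \<open>z \<otimes> y\<close> in \<open>D x\<close> with the foam value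
  \<open>\<theta> x (- y) (- z)\<close> (\<open>branch_split_iff\<close>), so a comultiplication prescribes all theta values.  The
  group-like one prescribes \<open>\<theta> x (- y) (- z) = 1\<close> if \<open>x = y = z\<close>, and \<open>0\<close> otherwise.  This is
  cyclically symmetric only if inversion is trivial: rotating \<open>\<theta> x (- x) (- x) = 1\<close> gives
  \<open>\<theta> (- x) (- x) x = 1\<close>, which in turn is a coefficient of \<open>D (- x)\<close> and is nonzero only for
  \<open>- x = x\<close> (\<open>split_grouplike_imp_neg_eq\<close>).

  Conversely, if \<open>- x = x\<close> throughout, the prescribed values are those of the trilinear form
  \<open>\<Sum>x. a\<^sub>x b\<^sub>x c\<^sub>x\<close>, which is symmetric.  Its branch split is the group-like
  comultiplication and its branch merge is the coefficientwise product.  That the group-like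
  comultiplication makes \<open>R[G]\<close> a bialgebra holds for every \<open>G\<close>, with the augmentation as counit
  (\<open>bialgebra_grouplike_comult\<close>).
\<close>

lemma smult_single: "smult r (Poly_Mapping.single x t) = Poly_Mapping.single x (r * t)"
  by (auto intro!: poly_mapping_eqI simp: lookup_smult lookup_single when_def)

lemma smult_basis: "smult r (basis x) = Poly_Mapping.single x r"
  by (simp add: basis_def smult_single)

lemma lookup_basis: "Poly_Mapping.lookup (basis x) y = (if x = y then 1 else 0)"
  by (simp add: basis_def lookup_single when_def)

lemma lin_ext_add: "module s \<Longrightarrow> lin_ext s g (a + b) = lin_ext s g a + lin_ext s g b"
  using lin_ext_hom[of s g] unfolding module_hom_iff by blast

lemma lin_ext_single: "module s \<Longrightarrow> lin_ext s g (Poly_Mapping.single x r) = s r (g x)"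
  using lin_ext_hom[of s g] lin_ext_basis[of s g x]
  unfolding module_hom_iff by (simp flip: smult_basis)

lemma lookup_lin_ext:
  "Poly_Mapping.lookup (lin_ext smult g a) k =
    (\<Sum>x\<in>Poly_Mapping.keys a. Poly_Mapping.lookup a x * Poly_Mapping.lookup (g x) k)"
  by (simp add: lin_ext_def lookup_sum lookup_smult)


section \<open>Foam values as coefficients\<close>

text \<open>
  The finiteness condition that accompanies every tube-cutting sum is automatic once the
  coefficients are those of an element of the group ring, so the sums can be traded for
  statements about single coefficients.
\<close>

lemma finite_Sum_any_basis_iff:
  fixes c :: "'k \<Rightarrow> 'r::comm_ring_1" and f :: "'k \<Rightarrow> 'l"
  assumes "bij f"
  shows "finite {k. c k \<noteq> 0} \<and> w = Sum_any (\<lambda>k. smult (c k) (basis (f k))) \<longleftrightarrow>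
    (\<forall>k. Poly_Mapping.lookup w (f k) = c k)"
proof -
  have coeff: "Poly_Mapping.lookup (Sum_any (\<lambda>k. smult (c k) (basis (f k)))) (f k) = c k"
    if fin: "finite {k. c k \<noteq> 0}" for k
  proof -
    have "Sum_any (\<lambda>k. smult (c k) (basis (f k))) =
        (\<Sum>k | c k \<noteq> 0. smult (c k) (basis (f k)))"
      by (rule Sum_any.expand_superset[OF fin]) (auto simp: smult_basis)
    moreover have "Poly_Mapping.lookup (\<Sum>j | c j \<noteq> 0. smult (c j) (basis (f j))) (f k) =
        (\<Sum>j | c j \<noteq> 0. if j = k then c k else 0)"
      unfolding lookup_sum
      by (rule sum.cong) (auto simp: lookup_smult lookup_basis bij_is_inj[OF assms, THEN inj_eq])
    ultimately show ?thesis
      using fin by simp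
  qed
  show ?thesis
  proof (intro iffI conjI)
    assume w: "\<forall>k. Poly_Mapping.lookup w (f k) = c k"
    have "{k. c k \<noteq> 0} = f -` Poly_Mapping.keys w"
      using w by (auto simp: in_keys_iff)
    then show fin: "finite {k. c k \<noteq> 0}"
      using bij_is_inj[OF assms] by (simp add: finite_vimageI)
    show "w = Sum_any (\<lambda>k. smult (c k) (basis (f k)))"
    proof (rule poly_mapping_eqI)
      fix l
      obtain k where "l = f k"
        using bij_is_surj[OF assms] by (auto elim: surjE)
      then show "Poly_Mapping.lookup w l =
          Poly_Mapping.lookup (Sum_any (\<lambda>k. smult (c k) (basis (f k)))) l"
        using w coeff[OF fin] by simp
    qed
  qed (use coeff in auto)
qed

lemma branch_split_iff:
  "branch_split \<theta> D \<longleftrightarrow> module_hom smult smult D \<and>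
    (\<forall>x y z. Poly_Mapping.lookup (D x) (z, y) = \<theta> x (basis (- y)) (basis (- z)))"
proof -
  have "bij (\<lambda>(y :: 'a, z :: 'a). (z, y))"
    by (rule o_bij[of "\<lambda>(y, z). (z, y)"]) auto
  from finite_Sum_any_basis_iff[OF this,
      of "\<lambda>(y, z). \<theta> x (basis (- y)) (basis (- z))" "D x" for x]
  show ?thesis
    by (simp add: branch_split_def tensor_basis split_def)
qed

lemma branch_merge_iff:
  "branch_merge \<theta> m \<longleftrightarrow> module_hom smult smult m \<and>
    (\<forall>u v y. Poly_Mapping.lookup (m (u \<otimes> v)) (- y) = \<theta> (basis y) u v)"
  using finite_Sum_any_basis_iff[OF bij_uminus, of "\<lambda>y. \<theta> (basis y) u v" "m (u \<otimes> v)" for u v]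
  by (simp add: branch_merge_def)


section \<open>The group-like comultiplication\<close>

lemma lookup_grouplike_comult:
  "Poly_Mapping.lookup (grouplike_comult a) (z, y) =
    (if z = y then Poly_Mapping.lookup a y else 0)"
proof -
  have "Poly_Mapping.lookup (grouplike_comult a) (z, y) =
      (\<Sum>x\<in>Poly_Mapping.keys a. if x = y then (if z = y then Poly_Mapping.lookup a y else 0) else 0)"
    unfolding grouplike_comult_def lookup_lin_ext
    by (rule sum.cong) (auto simp: tensor_basis lookup_basis)
  then show ?thesis
    by (auto simp: in_keys_iff)
qed

lemma grouplike_comult_add:
  "grouplike_comult (a + b) = grouplike_comult a + grouplike_comult b"
  by (simp add: grouplike_comult_def lin_ext_add module_smult)

lemma grouplike_comult_single:
  "grouplike_comult (Poly_Mapping.single x r) = Poly_Mapping.single (x, x) r"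
  by (simp add: grouplike_comult_def lin_ext_single module_smult tensor_basis smult_basis)

lemma grouplike_comult_mult:
  "grouplike_comult (a * b) =
    grouplike_comult a * grouplike_comult (b :: 'g::ab_group_add \<Rightarrow>\<^sub>0 'r::comm_ring_1)"
proof (induct a rule: single_sum_induct)
  case (1 x r)
  show ?case
    by (induct b rule: single_sum_induct)
      (simp_all add: distrib_left grouplike_comult_add grouplike_comult_single mult_single)
qed (simp add: distrib_right grouplike_comult_add)

lemma bialgebra_grouplike_comult:
  "bialgebra_comult (grouplike_comult :: ('g::ab_group_add \<Rightarrow>\<^sub>0 'r::comm_ring_1) \<Rightarrow> _)"
proof -
  \<comment> \<open>the augmentation, i.e. the sum of the coefficients\<close>
  define e :: "('g \<Rightarrow>\<^sub>0 'r) \<Rightarrow> 'r" where "e = lin_ext (*) (\<lambda>_. 1)"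
  have e: "module_hom smult (*) e"
    unfolding e_def by (rule lin_ext_hom[OF module_mult])
  have e_basis: "e (basis x) = 1" for x
    by (simp add: e_def lin_ext_basis module_mult)
  have left: "contract_left e (grouplike_comult a) = a" for a
    by (induct a rule: single_sum_induct)
      (simp_all add: contract_left_def grouplike_comult_add grouplike_comult_single
        lin_ext_add lin_ext_single module_smult e_basis smult_basis smult_single)
  have right: "contract_right e (grouplike_comult a) = a" for a
    by (induct a rule: single_sum_induct)
      (simp_all add: contract_right_def grouplike_comult_add grouplike_comult_single
        lin_ext_add lin_ext_single module_smult e_basis smult_basis smult_single)
  have "grouplike_comult (1 :: 'g \<Rightarrow>\<^sub>0 'r) = 1"
    by (simp add: grouplike_comult_single zero_prod_def flip: single_one)
  moreover have "module_hom smult smult (grouplike_comult :: ('g \<Rightarrow>\<^sub>0 'r) \<Rightarrow> _)"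
    unfolding grouplike_comult_def by (rule lin_ext_hom[OF module_smult])
  ultimately show ?thesis
    unfolding bialgebra_comult_def using e left right grouplike_comult_mult by blast
qed


section \<open>Cyclic symmetry and inversion\<close>

lemma split_grouplike_imp_neg_eq:
  fixes \<theta> :: "('g::ab_group_add \<Rightarrow>\<^sub>0 'r::comm_ring_1) \<Rightarrow> ('g \<Rightarrow>\<^sub>0 'r) \<Rightarrow> ('g \<Rightarrow>\<^sub>0 'r) \<Rightarrow> 'r"
  assumes "theta_foam \<theta>" and split: "branch_split \<theta> grouplike_comult"
  shows "- x = (x :: 'g)"
proof (rule ccontr)
  assume neq: "- x \<noteq> x"
  have val: "\<theta> (basis w) (basis (- y)) (basis (- z)) = (if z = y \<and> w = y then 1 else 0)" for w y z
  proof -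
    have "Poly_Mapping.lookup (grouplike_comult (basis w)) (z, y) =
        \<theta> (basis w) (basis (- y)) (basis (- z))"
      using split unfolding branch_split_iff by blast
    then show ?thesis
      by (auto simp: lookup_grouplike_comult lookup_basis split: if_splits)
  qed
  have "\<theta> (basis x) (basis (- x)) (basis (- x)) = \<theta> (basis (- x)) (basis (- x)) (basis x)"
    using \<open>theta_foam \<theta>\<close> unfolding theta_foam_def by blast
  then show False
    using val[of x x x] val[of "- x" x "- x"] neq by simp
qed

text \<open>
  The theta values forced by the group-like comultiplication when inversion is trivial: \<open>1\<close> on
  three equal group elements, \<open>0\<close> on all other triples.
\<close>

definition diagonal_form ::
  "('k \<Rightarrow>\<^sub>0 'r) \<Rightarrow> ('k \<Rightarrow>\<^sub>0 'r) \<Rightarrow> ('k \<Rightarrow>\<^sub>0 'r) \<Rightarrow> 'r::comm_ring_1"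
  where "diagonal_form a b c =
    lin_ext (*) (\<lambda>x. Poly_Mapping.lookup b x * Poly_Mapping.lookup c x) a"

lemma theta_foam_diagonal_form: "theta_foam diagonal_form"
proof -
  have swap: "diagonal_form a b c = diagonal_form a c b" for a b c :: "'k \<Rightarrow>\<^sub>0 'r::comm_ring_1"
    by (simp add: diagonal_form_def mult.commute)
  have flip: "diagonal_form a b c = diagonal_form b a c" for a b c :: "'k \<Rightarrow>\<^sub>0 'r::comm_ring_1"
    using lin_ext_superset[OF module_mult, of "Poly_Mapping.keys a \<union> Poly_Mapping.keys b" a]
      lin_ext_superset[OF module_mult, of "Poly_Mapping.keys a \<union> Poly_Mapping.keys b" b]
    by (simp add: diagonal_form_def ac_simps)
  have linear: "module_hom smult (*) (\<lambda>a. diagonal_form a b c)"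
    for b c :: "'k \<Rightarrow>\<^sub>0 'r::comm_ring_1"
    unfolding diagonal_form_def by (rule lin_ext_hom[OF module_mult])
  have linear2: "module_hom smult (*) (\<lambda>b. diagonal_form a b c)"
    for a c :: "'k \<Rightarrow>\<^sub>0 'r::comm_ring_1"
    using linear[of a c] by (simp add: flip[of a])
  have linear3: "module_hom smult (*) (diagonal_form a b)"
    for a b :: "'k \<Rightarrow>\<^sub>0 'r::comm_ring_1"
    using linear2[of a b] by (simp add: swap[of a _ b])
  show ?thesis
    unfolding theta_foam_def
    by (intro conjI allI linear linear2 linear3) (metis swap flip)+
qed

lemma diagonal_form_basis:
  "diagonal_form (basis x) b c = Poly_Mapping.lookup b x * Poly_Mapping.lookup c x"
  by (simp add: diagonal_form_def lin_ext_basis module_mult)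

lemma diagonal_form_basis_basis:
  "diagonal_form a (basis y) (basis z) = (if z = y then Poly_Mapping.lookup a y else 0)"
proof -
  have "diagonal_form a (basis y) (basis z) = diagonal_form (basis y) (basis z) a"
    using theta_foam_diagonal_form unfolding theta_foam_def by blast
  then show ?thesis
    by (simp add: diagonal_form_basis lookup_basis)
qed

definition coefficientwise_mult :: "('k \<times> 'k \<Rightarrow>\<^sub>0 'r) \<Rightarrow> ('k \<Rightarrow>\<^sub>0 'r::comm_ring_1)"
  where "coefficientwise_mult = lin_ext smult (\<lambda>(x, y). if x = y then basis x else 0)"

lemma lookup_coefficientwise_mult:
  "Poly_Mapping.lookup (coefficientwise_mult w) x = Poly_Mapping.lookup w (x, x)"
proof -
  have "Poly_Mapping.lookup (coefficientwise_mult w) x =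
      (\<Sum>p\<in>Poly_Mapping.keys w. if p = (x, x) then Poly_Mapping.lookup w (x, x) else 0)"
    unfolding coefficientwise_mult_def lookup_lin_ext
    by (rule sum.cong) (auto simp: lookup_basis split: if_splits)
  then show ?thesis
    by (auto simp: in_keys_iff)
qed

lemma branch_merge_diagonal_form:
  assumes "\<And>x :: 'g::ab_group_add. - x = x"
  shows "branch_merge diagonal_form
    (coefficientwise_mult :: ('g \<times> 'g \<Rightarrow>\<^sub>0 'r::comm_ring_1) \<Rightarrow> _)"
proof -
  have "module_hom smult smult (coefficientwise_mult :: ('g \<times> 'g \<Rightarrow>\<^sub>0 'r) \<Rightarrow> _)"
    unfolding coefficientwise_mult_def by (rule lin_ext_hom[OF module_smult])
  then show ?thesis
    by (simp add: branch_merge_iff assms lookup_coefficientwise_mult lookup_tensor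
        diagonal_form_basis)
qed

lemma branch_split_diagonal_form:
  assumes "\<And>x :: 'g::ab_group_add. - x = x"
  shows "branch_split diagonal_form
    (grouplike_comult :: ('g \<Rightarrow>\<^sub>0 'r::comm_ring_1) \<Rightarrow> _)"
  using bialgebra_grouplike_comult[where 'g = 'g and 'r = 'r]
  by (simp add: branch_split_iff bialgebra_comult_def assms lookup_grouplike_comult
      diagonal_form_basis_basis)

lemma element_order_eq_2_iff: "element_order x = 2 \<longleftrightarrow> x \<noteq> 0 \<and> - x = x"
proof -
  have two: "((+) x ^^ 2) 0 = 0 \<longleftrightarrow> - x = x"
    by (simp add: numeral_2_eq_2 neg_eq_iff_add_eq_0)
  let ?P = "\<lambda>n. 0 < n \<and> ((+) x ^^ n) 0 = 0"
  show ?thesis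
  proof
    assume ord: "element_order x = 2"
    then have ex: "\<exists>n. ?P n" and least: "(LEAST n. ?P n) = 2"
      by (auto simp: element_order_def split: if_splits)
    have "?P 2"
      using LeastI_ex[OF ex] by (simp add: least)
    moreover have "\<not> ?P 1"
      by (rule not_less_Least) (simp add: least)
    ultimately show "x \<noteq> 0 \<and> - x = x"
      using two by simp
  next
    assume x: "x \<noteq> 0 \<and> - x = x"
    have "(LEAST n. ?P n) = 2"
    proof (rule Least_equality)
      show "?P 2" using x two by simp
      fix n assume n: "?P n"
      then have "n \<noteq> 1" using x by auto
      with n show "2 \<le> n" by simp
    qed
    moreover have "\<exists>n>0. ((+) x ^^ n) 0 = 0"
      using x two by (intro exI[of _ 2]) simp
    ultimately show "element_order x = 2"
      by (simp add: element_order_def)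
  qed
qed

theorem proposition4p1:
  shows "(\<exists>(\<theta> :: ('g::ab_group_add \<Rightarrow>\<^sub>0 'r::comm_ring_1) \<Rightarrow> ('g \<Rightarrow>\<^sub>0 'r) \<Rightarrow> ('g \<Rightarrow>\<^sub>0 'r) \<Rightarrow> 'r)
            (m :: ('g \<times> 'g \<Rightarrow>\<^sub>0 'r) \<Rightarrow> ('g \<Rightarrow>\<^sub>0 'r))
            (D :: ('g \<Rightarrow>\<^sub>0 'r) \<Rightarrow> ('g \<times> 'g \<Rightarrow>\<^sub>0 'r)).
            theta_foam \<theta> \<and> branch_merge \<theta> m \<and> branch_split \<theta> D \<and>
            D = grouplike_comult \<and> bialgebra_comult D)
         \<longleftrightarrow> (\<forall>x::'g. x \<noteq> 0 \<longrightarrow> element_order x = 2)"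
proof
  assume "\<exists>(\<theta> :: ('g \<Rightarrow>\<^sub>0 'r) \<Rightarrow> ('g \<Rightarrow>\<^sub>0 'r) \<Rightarrow> ('g \<Rightarrow>\<^sub>0 'r) \<Rightarrow> 'r)
      (m :: ('g \<times> 'g \<Rightarrow>\<^sub>0 'r) \<Rightarrow> ('g \<Rightarrow>\<^sub>0 'r)) D.
      theta_foam \<theta> \<and> branch_merge \<theta> m \<and> branch_split \<theta> D \<and>
      D = grouplike_comult \<and> bialgebra_comult D"
  then show "\<forall>x::'g. x \<noteq> 0 \<longrightarrow> element_order x = 2"
    using split_grouplike_imp_neg_eq element_order_eq_2_iff by blast
next
  assume ord: "\<forall>x::'g. x \<noteq> 0 \<longrightarrow> element_order x = 2"
  have neg: "- x = x" for x :: 'g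
    using ord element_order_eq_2_iff[of x] by (cases "x = 0") auto
  show "\<exists>(\<theta> :: ('g \<Rightarrow>\<^sub>0 'r) \<Rightarrow> ('g \<Rightarrow>\<^sub>0 'r) \<Rightarrow> ('g \<Rightarrow>\<^sub>0 'r) \<Rightarrow> 'r)
      (m :: ('g \<times> 'g \<Rightarrow>\<^sub>0 'r) \<Rightarrow> ('g \<Rightarrow>\<^sub>0 'r)) D.
      theta_foam \<theta> \<and> branch_merge \<theta> m \<and> branch_split \<theta> D \<and>
      D = grouplike_comult \<and> bialgebra_comult D"
    using theta_foam_diagonal_form branch_merge_diagonal_form[OF neg]
      branch_split_diagonal_form[OF neg] bialgebra_grouplike_comult
    by blast
qed

end
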